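(* Let $\alpha$ be an irrational point of $\mathbb{R}/\mathbb{Z}$ and let $E_n=E_n(\alpha)$, $n=1,2,\dots$, be as defined in the context. Let $\beta\in\mathbb{Q}/\mathbb{Z}$. Then $f_\beta(\alpha)\neq 0$ if and only if $\beta\in E_n$ for some $n\ge 1$. Moreover, if $\beta\in E_n$ then $$f_\beta(\alpha)=(-1)^{n-1}q_{n-1}(\alpha).$$
   Context: Heights and Farey sets. Every $\beta\in\mathbb{Q}/\mathbb{Z}$ can be written $\beta=a/q$ with $q\ge1$ and $\gcd(a,q)=1$. Its height is $h(\beta)=q$, the order of $\beta$ in $\mathbb{Q}/\mathbb{Z}$. For $Q\ge1$ put $\mathcal{F}_Q=\{\beta\in\mathbb{Q}/\mathbb{Z}:h(\beta)\le Q\}$. Arcs. For distinct $a,b\in\mathbb{R}/\mathbb{Z}$ let $I(a,b)=\{a+t \bmod 1: 0<t<d\}$, where $d\in(0,1)$ satisfies $d\equiv b-a \pmod 1$. This is the open arc running in the positive direction from $a$ to $b$; write $\overline{I}(a,b)$ for its closure. The maps $\beta\mapsto\beta',\beta''$. Let $\beta\ne0$ with $h(\beta)=Q$. Then $\beta'$ is the unique point of $\mathcal{F}_Q$ such that $I(\beta',\beta)$ contains no point of $\mathcal{F}_Q$. Likewise $\beta''$ is the unique point of $\mathcal{F}_Q$ such that $I(\beta,\beta'')$ contains no point of $\mathcal{F}_Q$. Sawtooth function: $\psi(x)=x-[x]-\tfrac12$ for $x\notin\mathbb{Z}$ and $\psi(x)=0$ for $x\in\mathbb{Z}$; it is viewed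 as a function on $\mathbb{R}/\mathbb{Z}$. The functions $f_\beta:\mathbb{R}/\mathbb{Z}\to\mathbb{R}$. Put $f_0\equiv1$. For $\beta\neq0$ put $$f_\beta(x)=h(\beta)\psi(x-\beta)-h(\beta')\psi(x-\beta')-h(\beta'')\psi(x-\beta'').$$ Equivalently, $f_\beta=h(\beta')$ on $I(\beta',\beta)$, $f_\beta=-h(\beta'')$ on $I(\beta,\beta'')$, and $f_\beta=0$ outside $\overline{I}(\beta',\beta'')$. Continued fractions. Identify an irrational $\alpha\in\mathbb{R}/\mathbb{Z}$ with its representative in $(0,1)$. Write $\alpha=[0;a_1,a_2,\dots]$ for its simple continued fraction expansion. Set $p_{-2}=0$, $q_{-2}=1$, $p_{-1}=1$, $q_{-1}=0$, and for $n\ge0$ set $p_n=a_np_{n-1}+p_{n-2}$ and $q_n=a_nq_{n-1}+q_{n-2}$, with $a_0=0$. For $n\ge1$, $$E_n(\alpha)=\left\{\frac{mp_{n-1}+p_{n-2}}{mq_{n-1}+q_{n-2}}:m=1,\dots,a_n\right\},$$ viewed as a subset of $\mathbb{Q}/\mathbb{Z}$. It consists of the convergent $p_n/q_n$ together with the intermediate convergents. *)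

theory Defs
  imports Complex_Main
begin

text \<open>The additive group \<open>\<real>/\<int>\<close>; \<open>mod_one\<close> is the projection from the reals.\<close>

quotient_type circle = real / "\<lambda>x y. x - y \<in> \<int>"
  morphisms rep_circle mod_one
proof (rule equivpI)
  show "reflp (\<lambda>x y :: real. x - y \<in> \<int>)"
    by (simp add: reflp_def)
  show "symp (\<lambda>x y :: real. x - y \<in> \<int>)"
    by (metis (no_types, lifting) Ints_minus minus_diff_eq sympI)
  show "transp (\<lambda>x y :: real. x - y \<in> \<int>)"
  proof (rule transpI)
    fix x y z :: real
    assume "x - y \<in> \<int>" "y - z \<in> \<int>"
    then have "(x - y) + (y - z) \<in> \<int>" by (rule Ints_add)
    then show "x - z \<in> \<int>" by simp
  qed
qed

instantiation circle :: ab_group_add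
begin

lift_definition zero_circle :: circle is "0 :: real" .

lift_definition plus_circle :: "circle \<Rightarrow> circle \<Rightarrow> circle" is "(+) :: real \<Rightarrow> _"
proof -
  fix x x' y y' :: real
  assume "x - x' \<in> \<int>" "y - y' \<in> \<int>"
  then have "(x - x') + (y - y') \<in> \<int>" by (rule Ints_add)
  then show "(x + y) - (x' + y') \<in> \<int>" by (simp add: algebra_simps)
qed

lift_definition uminus_circle :: "circle \<Rightarrow> circle" is "uminus :: real \<Rightarrow> _"
  by (metis (no_types, opaque_lifting) Ints_minus minus_diff_minus)

lift_definition minus_circle :: "circle \<Rightarrow> circle \<Rightarrow> circle" is "(-) :: real \<Rightarrow> _"
proof -
  fix x x' y y' :: real
  assume "x - x' \<in> \<int>" "y - y' \<in> \<int>"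
  then have "(x - x') - (y - y') \<in> \<int>" by (rule Ints_diff)
  then show "(x - y) - (x' - y') \<in> \<int>" by (simp add: algebra_simps)
qed

instance
  by standard (transfer; simp add: algebra_simps)+

end

text \<open>The subgroup \<open>\<rat>/\<int>\<close>.\<close>

definition rat_circle :: "circle set" where
  "rat_circle = mod_one ` \<rat>"

definition height :: "circle \<Rightarrow> nat" where
  "height \<beta> = (THE q. q \<ge> 1 \<and>
     (\<exists>a :: int. coprime a (int q) \<and> \<beta> = mod_one (of_int a / of_nat q)))"

definition farey :: "nat \<Rightarrow> circle set" where
  "farey Q = {\<beta> \<in> rat_circle. height \<beta> \<le> Q}"

text \<open>Only meaningful for distinct endpoints.\<close>

definition arc_length :: "circle \<Rightarrow> circle \<Rightarrow> real" where
  "arc_length a b = (THE d. 0 < d \<and> d < 1 \<and> mod_one d = b - a)"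

definition open_arc :: "circle \<Rightarrow> circle \<Rightarrow> circle set" where
  "open_arc a b = {a + mod_one t | t. 0 < t \<and> t < arc_length a b}"

text \<open>The points \<open>\<beta>'\<close> and \<open>\<beta>''\<close>, for \<open>\<beta> \<noteq> 0\<close> in \<open>\<rat>/\<int>\<close>. They coincide for \<open>\<beta> = 1/2\<close>.\<close>

definition left_nb :: "circle \<Rightarrow> circle" where
  "left_nb \<beta> = (THE \<gamma>. \<gamma> \<in> farey (height \<beta>) \<and> \<gamma> \<noteq> \<beta> \<and>
     open_arc \<gamma> \<beta> \<inter> farey (height \<beta>) = {})"

definition right_nb :: "circle \<Rightarrow> circle" where
  "right_nb \<beta> = (THE \<gamma>. \<gamma> \<in> farey (height \<beta>) \<and> \<gamma> \<noteq> \<beta> \<and>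
     open_arc \<beta> \<gamma> \<inter> farey (height \<beta>) = {})"

lift_definition sawtooth :: "circle \<Rightarrow> real" is
  "\<lambda>x :: real. if x \<in> \<int> then 0 else x - of_int \<lfloor>x\<rfloor> - 1 / 2"
proof -
  fix x y :: real
  assume "x - y \<in> \<int>"
  then obtain k :: int where "x - y = of_int k" by (elim Ints_cases)
  then have x: "x = y + of_int k" by simp
  have "x \<in> \<int> \<longleftrightarrow> y \<in> \<int>"
    unfolding x by (metis Ints_add Ints_diff Ints_of_int add_diff_cancel_right')
  then show "(if x \<in> \<int> then 0 else x - of_int \<lfloor>x\<rfloor> - 1 / 2) =
             (if y \<in> \<int> then 0 else y - of_int \<lfloor>y\<rfloor> - 1 / 2)"
    by (simp add: x)
qed

definition farey_fun :: "circle \<Rightarrow> circle \<Rightarrow> real" where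
  "farey_fun \<beta> x = (if \<beta> = 0 then 1 else
     of_nat (height \<beta>) * sawtooth (x - \<beta>)
     - of_nat (height (left_nb \<beta>)) * sawtooth (x - left_nb \<beta>)
     - of_nat (height (right_nb \<beta>)) * sawtooth (x - right_nb \<beta>))"

text \<open>The representative in \<open>[0,1)\<close>, which lies in \<open>(0,1)\<close> for an irrational point.\<close>

lift_definition unit_rep :: "circle \<Rightarrow> real" is "frac :: real \<Rightarrow> real"
proof -
  fix x y :: real
  assume "x - y \<in> \<int>"
  then obtain k :: int where "x - y = of_int k" by (elim Ints_cases)
  then have "x = y + of_int k" by simp
  then show "frac x = frac y" by (simp add: frac_def)
qed

text \<open>Complete quotients \<open>[a\<^sub>n; a\<^sub>n\<^sub>+\<^sub>1, \<dots>]\<close> and partial quotients \<open>a\<^sub>n\<close> of the simple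
  continued fraction expansion of an irrational point.\<close>

fun complete_quot :: "circle \<Rightarrow> nat \<Rightarrow> real" where
  "complete_quot \<alpha> 0 = unit_rep \<alpha>"
| "complete_quot \<alpha> (Suc n) = 1 / frac (complete_quot \<alpha> n)"

definition partial_quot :: "circle \<Rightarrow> nat \<Rightarrow> int" where
  "partial_quot \<alpha> n = \<lfloor>complete_quot \<alpha> n\<rfloor>"

text \<open>The recursions start at index \<open>-2\<close>: the auxiliary functions are shifted by two, so that
  \<open>cf_p \<alpha> k\<close> and \<open>cf_q \<alpha> k\<close> are \<open>p\<^sub>k\<close> and \<open>q\<^sub>k\<close> for every integer \<open>k \<ge> -2\<close>.\<close>

fun cf_p_shift :: "circle \<Rightarrow> nat \<Rightarrow> int" where
  "cf_p_shift \<alpha> 0 = 0"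
| "cf_p_shift \<alpha> (Suc 0) = 1"
| "cf_p_shift \<alpha> (Suc (Suc n)) = partial_quot \<alpha> n * cf_p_shift \<alpha> (Suc n) + cf_p_shift \<alpha> n"

fun cf_q_shift :: "circle \<Rightarrow> nat \<Rightarrow> int" where
  "cf_q_shift \<alpha> 0 = 1"
| "cf_q_shift \<alpha> (Suc 0) = 0"
| "cf_q_shift \<alpha> (Suc (Suc n)) = partial_quot \<alpha> n * cf_q_shift \<alpha> (Suc n) + cf_q_shift \<alpha> n"

definition cf_p :: "circle \<Rightarrow> int \<Rightarrow> int" where
  "cf_p \<alpha> k = cf_p_shift \<alpha> (nat (k + 2))"

definition cf_q :: "circle \<Rightarrow> int \<Rightarrow> int" where
  "cf_q \<alpha> k = cf_q_shift \<alpha> (nat (k + 2))"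

definition convergent_set :: "circle \<Rightarrow> nat \<Rightarrow> circle set" where
  "convergent_set \<alpha> n =
     {mod_one (of_int (m * cf_p \<alpha> (int n - 1) + cf_p \<alpha> (int n - 2)) /
               of_int (m * cf_q \<alpha> (int n - 1) + cf_q \<alpha> (int n - 2)))
      | m :: int. 1 \<le> m \<and> m \<le> partial_quot \<alpha> n}"

end

theory Submission
  imports Defs
begin

text \<open>A fraction \<open>p/q\<close> is the mediant of its Farey neighbours \<open>a/b < c/d\<close>, where \<open>bc - ad = 1\<close>. In
  \<open>f\<^sub>\<beta>\<close> the linear parts of the sawtooth functions therefore cancel, and the integer parts give the
  value \<open>b\<close> on \<open>(a/b, p/q)\<close>, \<open>-d\<close> on \<open>(p/q, c/d)\<close> and \<open>0\<close> elsewhere. So \<open>f\<^sub>\<beta>(\<alpha>) \<noteq> 0\<close> means that the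
  pair \<open>a/b, c/d\<close> encloses \<open>\<alpha>\<close>. By descent in the Stern--Brocot tree such a pair consists of
  \<open>p\<^sub>n\<^sub>-\<^sub>1/q\<^sub>n\<^sub>-\<^sub>1\<close> and \<open>(m p\<^sub>n\<^sub>-\<^sub>1 + p\<^sub>n\<^sub>-\<^sub>2)/(m q\<^sub>n\<^sub>-\<^sub>1 + q\<^sub>n\<^sub>-\<^sub>2)\<close> with \<open>0 \<le> m < a\<^sub>n\<close>, whose mediant is a
  point of \<open>E\<^sub>n\<close>; the parity of \<open>n\<close> tells on which side of \<open>\<alpha>\<close> it lies.\<close>

section \<open>Rational points of the circle\<close>

lemma mod_one_eq_iff: "mod_one x = mod_one y \<longleftrightarrow> x - y \<in> \<int>"
  by (rule circle.abs_eq_iff)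

lemma mod_one_eq_0_iff: "mod_one x = 0 \<longleftrightarrow> x \<in> \<int>"
  unfolding zero_circle_def by (simp add: mod_one_eq_iff)

lemma mod_one_unit_rep: "mod_one (unit_rep \<alpha>) = \<alpha>"
proof (transfer)
  fix x :: real
  show "frac x - x \<in> \<int>" by (simp add: frac_def)
qed

lemma unit_rep_nonneg: "0 \<le> unit_rep \<alpha>" and unit_rep_less_1: "unit_rep \<alpha> < 1"
  by (transfer, simp add: frac_lt_1)+

text \<open>Clearing denominators gives \<open>a * r = q * (b + k * r)\<close>, and \<open>q\<close>
  is coprime to \<open>a\<close>. Used in both directions, this makes the reduced denominator of a
  point unique, so that \<open>height\<close> is well defined.\<close>

lemma mod_one_fraction_eq_imp_dvd:
  fixes a b q r :: int
  assumes "coprime a q" "q > 0" "r > 0"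
    and "mod_one (of_int a / of_int q) = mod_one (of_int b / of_int r)"
  shows "q dvd r"
proof -
  obtain k :: int where "real_of_int a / of_int q - of_int b / of_int r = of_int k"
    using assms(4) by (auto simp: mod_one_eq_iff elim: Ints_cases)
  then have "real_of_int (a * r) = of_int (q * (b + k * r))"
    using assms(2,3) by (simp add: field_simps)
  then have "a * r = q * (b + k * r)"
    by (rule of_int_eq_iff[THEN iffD1])
  then show ?thesis
    using assms(1) by (metis coprime_commute coprime_dvd_mult_right_iff dvd_triv_left)
qed

lemma height_mod_one:
  fixes a q :: int
  assumes "coprime a q" "q > 0"
  shows "height (mod_one (of_int a / of_int q)) = nat q"
  unfolding height_def
proof (rule the_equality)
  show "nat q \<ge> 1 \<and> (\<exists>b. coprime b (int (nat q)) \<and>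
      mod_one (of_int a / of_int q) = mod_one (of_int b / of_nat (nat q)))"
    using assms by (auto intro!: exI[of _ a])
next
  fix r :: nat
  assume "r \<ge> 1 \<and> (\<exists>b. coprime b (int r) \<and>
      mod_one (of_int a / of_int q) = mod_one (of_int b / of_nat r))"
  then obtain b where b: "r \<ge> 1" "coprime b (int r)"
    "mod_one (of_int a / of_int q) = mod_one (of_int b / of_int (int r))" by auto
  have "q dvd int r"
    using mod_one_fraction_eq_imp_dvd[OF assms _ b(3)] b(1) by simp
  moreover have "int r dvd q"
    using mod_one_fraction_eq_imp_dvd[OF b(2) _ _ b(3)[symmetric]] b(1) assms(2) by simp
  ultimately have "q = int r"
    using assms(2) by (simp add: zdvd_antisym_nonneg)
  then show "r = nat q" by simp
qed

lemma rat_circle_fraction: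
  assumes "\<beta> \<in> rat_circle"
  obtains a q :: int where "q > 0" "coprime a q" "0 \<le> a" "a < q"
    "\<beta> = mod_one (of_int a / of_int q)"
proof -
  obtain x where "x \<in> \<rat>" "\<beta> = mod_one x"
    using assms by (auto simp: rat_circle_def)
  then obtain b q :: int where bq: "q > 0" "coprime b q" "\<beta> = mod_one (of_int b / of_int q)"
    by (auto elim: Rats_cases')
  have "real_of_int b / of_int q - of_int (b mod q) / of_int q = of_int (b div q)"
  proof -
    have "real_of_int b = of_int (q * (b div q) + b mod q)" by simp
    then have "real_of_int b = of_int q * of_int (b div q) + of_int (b mod q)"
      by (simp only: of_int_add of_int_mult)
    then show ?thesis using bq(1) by (simp add: field_simps)
  qed
  then have "\<beta> = mod_one (of_int (b mod q) / of_int q)"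
    unfolding bq(3) mod_one_eq_iff by (metis Ints_of_int)
  moreover have "coprime (b mod q) q"
    using bq by (simp add: coprime_mod_left_iff)
  ultimately show thesis
    using bq(1) by (intro that[of q "b mod q"]) auto
qed

text \<open>The integer shift between two lifts is absorbed into the numerator, so Farey points can
  be compared as fractions on the real line.\<close>

lemma mod_one_in_farey_imp_fraction:
  assumes "mod_one x \<in> farey Q"
  obtains a b :: int where "0 < b" "b \<le> int Q" "x = of_int a / of_int b"
proof -
  obtain a b :: int where ab: "b > 0" "coprime a b" "mod_one x = mod_one (of_int a / of_int b)"
    using assms rat_circle_fraction[of "mod_one x"] unfolding farey_def by blast
  have "nat b \<le> Q"
    using assms ab height_mod_one[of a b] by (simp add: farey_def)
  moreover obtain k :: int where "x - of_int a / of_int b = of_int k"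
    using ab(3) by (auto simp: mod_one_eq_iff elim: Ints_cases)
  then have "x = of_int (a + k * b) / of_int b"
    using ab(1) by (simp add: field_simps)
  ultimately show thesis
    using ab(1) by (intro that[of b "a + k * b"]) auto
qed

lemma fraction_in_farey:
  fixes a q :: int
  assumes "coprime a q" "0 < q" "q \<le> int Q"
  shows "mod_one (of_int a / of_int q) \<in> farey Q"
  using assms by (auto simp: farey_def height_mod_one rat_circle_def)

section \<open>Arcs of the circle and lifts to the real line\<close>

lemma arc_length_mod_one:
  assumes "x < y" "y < x + 1"
  shows "arc_length (mod_one x) (mod_one y) = y - x"
  unfolding arc_length_def minus_circle.abs_eq
proof (rule the_equality)
  show "0 < y - x \<and> y - x < 1 \<and> mod_one (y - x) = mod_one (y - x)"
    using assms by simp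
next
  fix d assume d: "0 < d \<and> d < 1 \<and> mod_one d = mod_one (y - x)"
  then obtain k :: int where k: "d - (y - x) = of_int k"
    by (auto simp: mod_one_eq_iff elim: Ints_cases)
  moreover have "\<bar>d - (y - x)\<bar> < 1" using assms d by linarith
  ultimately have "k = 0" by linarith
  then show "d = y - x" using k by simp
qed

lemma open_arc_mod_one:
  assumes "x < y" "y < x + 1"
  shows "open_arc (mod_one x) (mod_one y) = mod_one ` {x<..<y}"
proof -
  have "open_arc (mod_one x) (mod_one y) = {mod_one (x + t) |t. 0 < t \<and> t < y - x}"
    by (simp add: open_arc_def arc_length_mod_one[OF assms] plus_circle.abs_eq)
  also have "\<dots> = mod_one ` {x<..<y}"
  proof safe
    fix t assume "0 < t" "t < y - x"
    then show "mod_one (x + t) \<in> mod_one ` {x<..<y}" by auto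
  next
    fix z assume "z \<in> {x<..<y}"
    then show "\<exists>t. mod_one z = mod_one (x + t) \<and> 0 < t \<and> t < y - x"
      by (intro exI[of _ "z - x"]) auto
  qed
  finally show ?thesis .
qed

lemma circle_lift_above:
  assumes "\<gamma> \<noteq> mod_one y"
  obtains x where "\<gamma> = mod_one x" "y < x" "x < y + 1"
proof -
  obtain z where z: "\<gamma> = mod_one z" by (metis mod_one_unit_rep)
  have "z - y \<notin> \<int>" using assms by (simp add: z mod_one_eq_iff)
  then have "0 < frac (z - y)" by (simp add: frac_gt_0_iff)
  moreover have "mod_one z = mod_one (y + frac (z - y))"
    by (simp add: mod_one_eq_iff frac_def)
  ultimately show thesis
    using that[of "y + frac (z - y)"] z frac_lt_1[of "z - y"] by simp
qed

lemma circle_lift_below: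
  assumes "\<gamma> \<noteq> mod_one y"
  obtains x where "\<gamma> = mod_one x" "x < y" "y < x + 1"
proof -
  obtain x where x: "\<gamma> = mod_one x" "y < x" "x < y + 1"
    using circle_lift_above[OF assms] .
  moreover have "mod_one x = mod_one (x - 1)" by (simp add: mod_one_eq_iff)
  ultimately show thesis by (intro that[of "x - 1"]) auto
qed

section \<open>Farey neighbours\<close>

lemma coprime_if_det_1:
  fixes a b c d :: int
  assumes "a * d - b * c = 1"
  shows "coprime a c" "coprime b d" "coprime a b" "coprime c d"
proof -
  have "e dvd 1" if "e dvd a \<and> e dvd c \<or> e dvd b \<and> e dvd d \<or> e dvd a \<and> e dvd b \<or> e dvd c \<and> e dvd d" for e
    unfolding assms[symmetric] using that by auto
  then show "coprime a c" "coprime b d" "coprime a b" "coprime c d"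
    by (rule coprimeI; blast)+
qed

text \<open>The integers \<open>r * b - a * s\<close> and \<open>c * s - r * d\<close> are positive,
  hence at least 1; by the determinant, \<open>d\<close> times the first plus \<open>b\<close> times
  the second is \<open>s\<close>.\<close>

lemma denominator_between_det_1:
  fixes a b c d r s :: int
  assumes det: "c * b - a * d = 1" and pos: "0 < b" "0 < d" "0 < s"
    and "of_int a / of_int b < (of_int r / of_int s :: real)"
    and "of_int r / of_int s < (of_int c / of_int d :: real)"
  shows "b + d \<le> s"
proof -
  have "real_of_int (a * s) < of_int (r * b)" "real_of_int (r * d) < of_int (c * s)"
    using assms by (simp_all add: field_simps)
  then have *: "a * s + 1 \<le> r * b" "r * d + 1 \<le> c * s" by linarith+
  have "d * (r * b - a * s) \<ge> d * 1" "b * (c * s - r * d) \<ge> b * 1"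
    using * pos by (intro mult_left_mono; simp)+
  moreover have "d * (r * b - a * s) + b * (c * s - r * d) = (c * b - a * d) * s"
    by (simp add: algebra_simps)
  ultimately show ?thesis using det by simp
qed

lemma det_1_diff:
  fixes a b c d :: int
  assumes "c * b - a * d = 1" "0 < b" "0 < d"
  shows "(of_int c / of_int d :: real) - of_int a / of_int b = 1 / of_int (b * d)"
proof -
  have "real_of_int c * of_int b - of_int a * of_int d = 1"
    using assms(1) by (metis of_int_1 of_int_diff of_int_mult)
  then show ?thesis using assms(2,3) by (simp add: field_simps)
qed

lemma det_1_less:
  fixes a b c d :: int
  assumes "c * b - a * d = 1" "0 < b" "0 < d"
  shows "(of_int a / of_int b :: real) < of_int c / of_int d"
proof -
  have "0 < 1 / real_of_int (b * d)" using assms by simp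
  then show ?thesis using det_1_diff[OF assms] by linarith
qed

lemma det_1_le_plus_1:
  fixes a b c d :: int
  assumes "c * b - a * d = 1" "0 < b" "0 < d"
  shows "(of_int c / of_int d :: real) \<le> of_int a / of_int b + 1"
proof -
  have "1 \<le> b * d" using mult_pos_pos[OF assms(2,3)] by linarith
  then have "1 / real_of_int (b * d) \<le> 1" by (simp del: of_int_mult)
  then show ?thesis using det_1_diff[OF assms] by linarith
qed

text \<open>The excluded case \<open>b = d = 1\<close> gives two consecutive integers, that is, one
  point of the circle and no proper arc.\<close>

lemma det_1_less_plus_1:
  fixes a b c d :: int
  assumes "c * b - a * d = 1" "0 < b" "0 < d" "1 < b \<or> 1 < d"
  shows "(of_int c / of_int d :: real) < of_int a / of_int b + 1"
proof -
  have "1 < b * d"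
    using assms(4)
  proof
    assume "1 < b"
    then show ?thesis using mult_left_mono[of 1 d b] assms(2,3) by linarith
  next
    assume "1 < d"
    then show ?thesis using mult_right_mono[of 1 b d] assms(2,3) by linarith
  qed
  then have "1 / real_of_int (b * d) < 1" by (simp del: of_int_mult)
  then show ?thesis using det_1_diff[OF assms(1-3)] by linarith
qed

lemma farey_det_1_gap:
  fixes a b c d :: int
  assumes "c * b - a * d = 1" "0 < b" "0 < d" "1 < b \<or> 1 < d" "int Q < b + d"
  shows "open_arc (mod_one (of_int a / of_int b)) (mod_one (of_int c / of_int d)) \<inter> farey Q = {}"
proof -
  have "mod_one z \<notin> farey Q" if "of_int a / of_int b < z" "z < of_int c / of_int d" for z
  proof
    assume "mod_one z \<in> farey Q"
    then obtain r s :: int where "0 < s" "s \<le> int Q" "z = of_int r / of_int s"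
      by (rule mod_one_in_farey_imp_fraction)
    then show False
      using denominator_between_det_1[OF assms(1-3), of s r] that assms(5) by simp
  qed
  then show ?thesis
    using det_1_less[OF assms(1-3)] det_1_less_plus_1[OF assms(1-4)]
    by (auto simp: open_arc_mod_one)
qed

text \<open>A fraction strictly between the two has denominator at least \<open>q + q'\<close>, so
  the arc contains no Farey point of order \<open>q\<close>. For uniqueness, another candidate is
  lifted to the period below \<open>y\<close>: further left, its arc would contain \<open>x\<close>;
  nearer, it would lie in the empty arc.\<close>

lemma left_nb_fraction:
  fixes p q p' q' :: int
  assumes det: "p * q' - p' * q = 1" and q': "0 < q'" "q' < q"
  shows "left_nb (mod_one (of_int p / of_int q)) = mod_one (of_int p' / of_int q')"
proof -
  define y x :: real where "y = of_int p / of_int q" and "x = of_int p' / of_int q'"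
  have xy: "x < y" "y < x + 1"
    using det_1_less[OF det] det_1_less_plus_1[OF det] q' by (auto simp: x_def y_def)
  have cop: "coprime p q" "coprime p' q'"
    using coprime_if_det_1[of p q' p' q] det by (simp_all)
  have h: "height (mod_one y) = nat q"
    using q' cop by (simp add: y_def height_mod_one)
  have xF: "mod_one x \<in> farey (nat q)"
    using q' cop by (auto simp: x_def intro!: fraction_in_farey)
  have gap: "open_arc (mod_one x) (mod_one y) \<inter> farey (nat q) = {}"
    unfolding x_def y_def using q' by (intro farey_det_1_gap det) auto
  have "left_nb (mod_one y) = mod_one x"
    unfolding left_nb_def h
  proof (rule the_equality)
    show "mod_one x \<in> farey (nat q) \<and> mod_one x \<noteq> mod_one y \<and>
        open_arc (mod_one x) (mod_one y) \<inter> farey (nat q) = {}"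
    proof (intro conjI xF gap notI)
      assume "mod_one x = mod_one y"
      then obtain k :: int where "x - y = of_int k"
        by (auto simp: mod_one_eq_iff elim: Ints_cases)
      then have "real_of_int (- 1) < real_of_int k" "real_of_int k < real_of_int 0" using xy by linarith+
      then show False unfolding of_int_less_iff by linarith
    qed
  next
    fix \<gamma>
    assume \<gamma>: "\<gamma> \<in> farey (nat q) \<and> \<gamma> \<noteq> mod_one y \<and> open_arc \<gamma> (mod_one y) \<inter> farey (nat q) = {}"
    then obtain z where z: "\<gamma> = mod_one z" "z < y" "y < z + 1"
      using circle_lift_below by blast
    have "\<not> z < x"
    proof
      assume "z < x"
      then have "mod_one x \<in> open_arc \<gamma> (mod_one y)"
        using z xy by (simp add: open_arc_mod_one)
      then show False using \<gamma> xF by blast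
    qed
    moreover have "\<not> x < z"
    proof
      assume "x < z"
      then have "\<gamma> \<in> open_arc (mod_one x) (mod_one y)"
        using z xy by (simp add: open_arc_mod_one)
      then show False using \<gamma> gap by blast
    qed
    ultimately show "\<gamma> = mod_one x" using z by simp
  qed
  then show ?thesis by (simp add: x_def y_def)
qed

text \<open>Mirror image of \<open>left_nb_fraction\<close>, with lifts in the period above
  \<open>y\<close>.\<close>

lemma right_nb_fraction:
  fixes p q p' q' :: int
  assumes det: "p' * q - p * q' = 1" and q': "0 < q'" "q' < q"
  shows "right_nb (mod_one (of_int p / of_int q)) = mod_one (of_int p' / of_int q')"
proof -
  define y x :: real where "y = of_int p / of_int q" and "x = of_int p' / of_int q'"
  have xy: "y < x" "x < y + 1"
    using det_1_less[OF det] det_1_less_plus_1[OF det] q' by (auto simp: x_def y_def)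
  have cop: "coprime p q" "coprime p' q'"
    using coprime_if_det_1[of p' q p q'] det by (simp_all)
  have h: "height (mod_one y) = nat q"
    using q' cop by (simp add: y_def height_mod_one)
  have xF: "mod_one x \<in> farey (nat q)"
    using q' cop by (auto simp: x_def intro!: fraction_in_farey)
  have gap: "open_arc (mod_one y) (mod_one x) \<inter> farey (nat q) = {}"
    unfolding x_def y_def using q' by (intro farey_det_1_gap det) auto
  have "right_nb (mod_one y) = mod_one x"
    unfolding right_nb_def h
  proof (rule the_equality)
    show "mod_one x \<in> farey (nat q) \<and> mod_one x \<noteq> mod_one y \<and>
        open_arc (mod_one y) (mod_one x) \<inter> farey (nat q) = {}"
    proof (intro conjI xF gap notI)
      assume "mod_one x = mod_one y"
      then obtain k :: int where "x - y = of_int k"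
        by (auto simp: mod_one_eq_iff elim: Ints_cases)
      then have "real_of_int 0 < real_of_int k" "real_of_int k < real_of_int 1" using xy by linarith+
      then show False unfolding of_int_less_iff by linarith
    qed
  next
    fix \<gamma>
    assume \<gamma>: "\<gamma> \<in> farey (nat q) \<and> \<gamma> \<noteq> mod_one y \<and> open_arc (mod_one y) \<gamma> \<inter> farey (nat q) = {}"
    then obtain z where z: "\<gamma> = mod_one z" "y < z" "z < y + 1"
      using circle_lift_above by blast
    have "\<not> x < z"
    proof
      assume "x < z"
      then have "mod_one x \<in> open_arc (mod_one y) \<gamma>"
        using z xy by (simp add: open_arc_mod_one)
      then show False using \<gamma> xF by blast
    qed
    moreover have "\<not> z < x"
    proof
      assume "z < x"
      then have "\<gamma> \<in> open_arc (mod_one y) (mod_one x)"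
        using z xy by (simp add: open_arc_mod_one)
      then show False using \<gamma> gap by blast
    qed
    ultimately show "\<gamma> = mod_one x" using z by simp
  qed
  then show ?thesis by (simp add: x_def y_def)
qed

section \<open>Values of the Farey functions at irrational points\<close>

lemma sawtooth_irrational_minus_fraction:
  fixes a b :: int
  assumes "x \<notin> \<rat>"
  shows "sawtooth (mod_one x - mod_one (of_int a / of_int b)) =
    x - of_int a / of_int b - of_int \<lfloor>x - of_int a / of_int b\<rfloor> - 1 / 2"
proof -
  have "x - of_int a / of_int b \<notin> \<int>"
  proof
    assume "x - of_int a / of_int b \<in> \<int>"
    then have "(x - of_int a / of_int b) + of_int a / of_int b \<in> \<rat>"
      using Ints_subset_Rats by (intro Rats_add Rats_divide) auto
    then show False using assms by simp
  qed
  then show ?thesis by (simp add: minus_circle.abs_eq sawtooth.abs_eq)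
qed

text \<open>The mediant has determinant 1 with each of its parents, which are therefore its Farey
  neighbours. Everything but the floors cancels, since denominators and numerators both add
  up.\<close>

lemma farey_fun_eq_floors:
  fixes a b c d :: int
  assumes det: "c * b - a * d = 1" and pos: "0 < b" "0 < d" and x: "x \<notin> \<rat>"
  shows "farey_fun (mod_one (of_int (a + c) / of_int (b + d))) (mod_one x) =
    of_int (b * \<lfloor>x - of_int a / of_int b\<rfloor> + d * \<lfloor>x - of_int c / of_int d\<rfloor>
      - (b + d) * \<lfloor>x - of_int (a + c) / of_int (b + d)\<rfloor>)"
proof -
  define \<beta> where "\<beta> = mod_one (of_int (a + c) / of_int (b + d))"
  have detl: "(a + c) * b - a * (b + d) = 1" and detr: "c * (b + d) - (a + c) * d = 1"
    using det by (simp_all add: algebra_simps)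
  have l: "left_nb \<beta> = mod_one (of_int a / of_int b)"
    unfolding \<beta>_def using pos by (intro left_nb_fraction detl) auto
  have r: "right_nb \<beta> = mod_one (of_int c / of_int d)"
    unfolding \<beta>_def using pos by (intro right_nb_fraction detr) auto
  have cop: "coprime (a + c) (b + d)" "coprime a b" "coprime c d"
    using coprime_if_det_1[OF detl] coprime_if_det_1[OF detr] by auto
  have h: "height \<beta> = nat (b + d)" "height (mod_one (of_int a / of_int b)) = nat b"
    "height (mod_one (of_int c / of_int d)) = nat d"
    unfolding \<beta>_def using pos cop by (intro height_mod_one; simp)+
  \<comment> \<open>The point 0 has height 1, whereas \<open>\<beta>\<close> has height
    \<open>b + d\<close>, at least 2; so \<open>farey_fun\<close> takes its sawtooth branch.\<close>
  have "mod_one 0 = mod_one (of_int 0 / of_int 1)" by simp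
  then have "height 0 = 1"
    using height_mod_one[of 0 1] by (simp add: zero_circle_def)
  then have "\<beta> \<noteq> 0" using h(1) pos by auto
  then have "farey_fun \<beta> (mod_one x) =
      of_int (b + d) * sawtooth (mod_one x - \<beta>)
      - of_int b * sawtooth (mod_one x - mod_one (of_int a / of_int b))
      - of_int d * sawtooth (mod_one x - mod_one (of_int c / of_int d))"
    using pos by (simp add: farey_fun_def h l r)
  also have "\<dots> = of_int (b + d) * (x - of_int (a + c) / of_int (b + d) - of_int \<lfloor>x - of_int (a + c) / of_int (b + d)\<rfloor> - 1 / 2)
      - of_int b * (x - of_int a / of_int b - of_int \<lfloor>x - of_int a / of_int b\<rfloor> - 1 / 2)
      - of_int d * (x - of_int c / of_int d - of_int \<lfloor>x - of_int c / of_int d\<rfloor> - 1 / 2)"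
    unfolding \<beta>_def sawtooth_irrational_minus_fraction[OF x] ..
  also have "\<dots> = of_int (b * \<lfloor>x - of_int a / of_int b\<rfloor> + d * \<lfloor>x - of_int c / of_int d\<rfloor>
      - (b + d) * \<lfloor>x - of_int (a + c) / of_int (b + d)\<rfloor>)"
  proof -
    have *: "of_int s * (x - of_int r / of_int s - of_int k - 1 / 2) =
        of_int s * x - of_int r - of_int s * of_int k - of_int s / 2" if "s > 0" for r s k :: int
      using that by (simp add: field_simps)
    have "b + d > 0" using pos by simp
    then show ?thesis
      unfolding *[OF pos(1)] *[OF pos(2)] *[OF \<open>b + d > 0\<close>]
      by (simp add: algebra_simps add_divide_distrib)
  qed
  finally show ?thesis unfolding \<beta>_def .
qed

text \<open>The floors at the left end, the right end and the mediant are 0, -1, -1, which leaves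
  \<open>- d + (b + d)\<close>. The non-strict bound on the gap suffices, so the pair 0/1, 1/1 is
  covered.\<close>

lemma farey_fun_left_of_mediant:
  fixes a b c d :: int
  assumes det: "c * b - a * d = 1" and pos: "0 < b" "0 < d" and x: "x \<notin> \<rat>"
    and "of_int a / of_int b < x" "x < of_int (a + c) / of_int (b + d)"
  shows "farey_fun (mod_one (of_int (a + c) / of_int (b + d))) (mod_one x) = of_int b"
proof -
  have detl: "(a + c) * b - a * (b + d) = 1" and detr: "c * (b + d) - (a + c) * d = 1"
    using det by (simp_all add: algebra_simps)
  have bd: "0 < b + d" using pos by simp
  note bounds = det_1_less[OF detr bd pos(2)] det_1_le_plus_1[OF det pos]
    det_1_le_plus_1[OF detl pos(1) bd] assms(5,6)
  have "\<lfloor>x - of_int a / of_int b\<rfloor> = 0" "\<lfloor>x - of_int c / of_int d\<rfloor> = - 1"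
    "\<lfloor>x - of_int (a + c) / of_int (b + d)\<rfloor> = - 1"
    unfolding floor_eq_iff using bounds by auto
  then show ?thesis by (simp add: farey_fun_eq_floors[OF det pos x] del: of_int_add)
qed

lemma farey_fun_right_of_mediant:
  fixes a b c d :: int
  assumes det: "c * b - a * d = 1" and pos: "0 < b" "0 < d" and x: "x \<notin> \<rat>"
    and "of_int (a + c) / of_int (b + d) < x" "x < of_int c / of_int d"
  shows "farey_fun (mod_one (of_int (a + c) / of_int (b + d))) (mod_one x) = - of_int d"
proof -
  have detl: "(a + c) * b - a * (b + d) = 1" and detr: "c * (b + d) - (a + c) * d = 1"
    using det by (simp_all add: algebra_simps)
  have bd: "0 < b + d" using pos by simp
  note bounds = det_1_less[OF detl pos(1) bd] det_1_le_plus_1[OF det pos]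
    det_1_le_plus_1[OF detr bd pos(2)] assms(5,6)
  have "\<lfloor>x - of_int a / of_int b\<rfloor> = 0" "\<lfloor>x - of_int c / of_int d\<rfloor> = - 1"
    "\<lfloor>x - of_int (a + c) / of_int (b + d)\<rfloor> = 0"
    unfolding floor_eq_iff using bounds by auto
  then show ?thesis by (simp add: farey_fun_eq_floors[OF det pos x] del: of_int_add)
qed

text \<open>Both ends lie in [0,1] together with \<open>x\<close>. If \<open>x\<close> is outside
  their interval, the three floors are therefore all -1 or all 0, and equal floors cancel.\<close>

lemma farey_fun_nonzero_imp_between:
  fixes a b c d :: int
  assumes det: "c * b - a * d = 1" and pos: "0 < b" "0 < d" and x: "x \<notin> \<rat>" "0 < x" "x < 1"
    and ac: "0 \<le> a" "c \<le> d"
    and nz: "farey_fun (mod_one (of_int (a + c) / of_int (b + d))) (mod_one x) \<noteq> 0"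
  shows "of_int a / of_int b < x \<and> x < of_int c / of_int d"
proof (rule ccontr)
  assume not: "\<not> ?thesis"
  have detl: "(a + c) * b - a * (b + d) = 1" and detr: "c * (b + d) - (a + c) * d = 1"
    using det by (simp_all add: algebra_simps)
  have bd: "0 < b + d" using pos by simp
  have "of_int a / of_int b \<noteq> x" using x(1) by (auto intro: Rats_divide)
  moreover have "of_int c / of_int d \<noteq> x" using x(1) by (auto intro: Rats_divide)
  ultimately consider "x < of_int a / of_int b" | "of_int c / of_int d < x"
    using not by linarith
  moreover have "0 \<le> real_of_int a / of_int b" "real_of_int c / of_int d \<le> 1"
    using ac pos by simp_all
  moreover note det_1_less[OF detl pos(1) bd] det_1_less[OF detr bd pos(2)] x(2,3)
  ultimately have "\<lfloor>x - of_int a / of_int b\<rfloor> = - 1 \<and> \<lfloor>x - of_int c / of_int d\<rfloor> = - 1 \<and>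
      \<lfloor>x - of_int (a + c) / of_int (b + d)\<rfloor> = - 1 \<or>
      \<lfloor>x - of_int a / of_int b\<rfloor> = 0 \<and> \<lfloor>x - of_int c / of_int d\<rfloor> = 0 \<and>
      \<lfloor>x - of_int (a + c) / of_int (b + d)\<rfloor> = 0"
    unfolding floor_eq_iff by cases auto
  then show False
    using nz unfolding farey_fun_eq_floors[OF det pos x(1)] by auto
qed

lemma mediant_decomposition:
  fixes p q :: int
  assumes "coprime p q" "0 < p" "p < q"
  obtains a b c d :: int where "c * b - a * d = 1" "0 < b" "0 < d" "0 \<le> a" "c \<le> d" "0 \<le> c"
    "p = a + c" "q = b + d"
proof -
  obtain u v where uv: "p * u + q * v = 1"
    using assms(1) bezout_int[of p q] by (auto simp: mult.commute)
  \<comment> \<open>The left parent has as denominator the inverse of \<open>p\<close> modulo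
    \<open>q\<close>; its numerator is then forced by the determinant.\<close>
  define b where "b = u mod q"
  define a where "a = - (v + p * (u div q))"
  have u: "u = q * (u div q) + b" by (simp add: b_def)
  have det: "p * b - a * q = 1"
  proof -
    have "p * b - a * q = p * (q * (u div q) + b) + q * v" by (simp add: a_def algebra_simps)
    then show ?thesis using u uv by simp
  qed
  have q: "1 < q" using assms by simp
  have "b \<noteq> 0"
  proof
    assume "b = 0"
    then have "q dvd 1" using det by (metis dvd_minus_iff dvd_triv_right mult_zero_right diff_0)
    then show False using q by simp
  qed
  moreover have "0 \<le> b" using q by (simp add: b_def)
  moreover have "b < q" using q by (simp add: b_def)
  ultimately have b: "0 < b" "b < q" by simp_all
  have a0: "0 \<le> a"
  proof -
    have "0 < p * b" using assms b by simp
    then have "0 \<le> a * q" using det by linarith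
    then show ?thesis using q by (simp add: zero_le_mult_iff)
  qed
  have ap: "a \<le> p"
  proof -
    have "p * b < p * q" using assms b by simp
    then have "a * q < p * q" using det by linarith
    then show ?thesis using q by (simp add: mult_less_cancel_right)
  qed
  have "(p - a) * q - p * (q - b) = 1" using det by (simp add: algebra_simps)
  have cd: "p - a \<le> q - b"
  proof (rule ccontr)
    assume "\<not> p - a \<le> q - b"
    \<comment> \<open>Together with the determinant, the two bounds yield
      \<open>q + (q - b) \<le> 1\<close>, which is impossible.\<close>
    then have "(q - b + 1) * q \<le> (p - a) * q" using q by (intro mult_right_mono) auto
    moreover have "p * (q - b) \<le> (q - 1) * (q - b)" using assms b by (intro mult_right_mono) auto
    ultimately show False
      using \<open>(p - a) * q - p * (q - b) = 1\<close> b q by (simp add: algebra_simps)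
  qed
  have "(p - a) * b - a * (q - b) = 1" using det by (simp add: algebra_simps)
  then show thesis using b a0 cd ap by (intro that[of "p - a" b a "q - b"]) auto
qed

section \<open>Continued fractions\<close>

context
  fixes \<alpha> :: circle
  assumes irr: "\<alpha> \<notin> rat_circle"
begin

section \<open>Complete and partial quotients of an irrational point\<close>

lemma unit_rep_irrational: "unit_rep \<alpha> \<notin> \<rat>"
  using irr mod_one_unit_rep[of \<alpha>] by (metis imageI rat_circle_def)

lemma unit_rep_pos: "0 < unit_rep \<alpha>"
  using unit_rep_irrational unit_rep_nonneg[of \<alpha>] by (metis Rats_0 order_le_less)

text \<open>Each complete quotient is recovered rationally from the next one, so rationality would
  propagate back to \<open>unit_rep \<alpha>\<close>. Hence the expansion never terminates.\<close>

lemma complete_quot_irrational: "complete_quot \<alpha> n \<notin> \<rat>"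
proof (induction n)
  case 0
  show ?case by (simp add: unit_rep_irrational)
next
  case (Suc n)
  show ?case
  proof
    assume "complete_quot \<alpha> (Suc n) \<in> \<rat>"
    then have "1 / complete_quot \<alpha> (Suc n) + of_int \<lfloor>complete_quot \<alpha> n\<rfloor> \<in> \<rat>"
      by (intro Rats_add Rats_divide) auto
    then show False using Suc by (simp add: frac_def)
  qed
qed

lemma frac_complete_quot_pos: "0 < frac (complete_quot \<alpha> n)"
  using complete_quot_irrational[of n] Ints_subset_Rats by (auto simp: frac_gt_0_iff)

lemma partial_quot_less: "of_int (partial_quot \<alpha> n) < complete_quot \<alpha> n"
  using frac_complete_quot_pos[of n] by (simp add: partial_quot_def frac_def)

lemma partial_quot_ge_1:
  assumes "n \<ge> 1"
  shows "1 \<le> partial_quot \<alpha> n"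
proof -
  obtain k where "n = Suc k" using assms by (cases n) auto
  moreover have "1 \<le> 1 / frac (complete_quot \<alpha> k)"
    using frac_complete_quot_pos[of k] frac_lt_1[of "complete_quot \<alpha> k"] by simp
  ultimately show ?thesis by (simp add: partial_quot_def le_floor_iff)
qed

lemma partial_quot_0: "partial_quot \<alpha> 0 = 0"
  using unit_rep_nonneg unit_rep_less_1 by (simp add: partial_quot_def floor_eq_iff)

lemma partial_quot_nonneg: "0 \<le> partial_quot \<alpha> n"
  using partial_quot_0 partial_quot_ge_1[of n] by (cases "n = 0") auto

section \<open>Convergents: denominators, determinants and errors\<close>

lemma cf_q_shift_nonneg: "0 \<le> cf_q_shift \<alpha> n"
proof (induction n rule: less_induct)
  case (less n)
  consider "n = 0" | "n = 1" | k where "n = Suc (Suc k)"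
    by (metis One_nat_def not0_implies_Suc)
  then show ?case by cases (auto simp: less partial_quot_nonneg)
qed

lemma cf_q_shift_ge_1: "1 \<le> cf_q_shift \<alpha> (Suc (Suc n))"
proof (induction n)
  case 0
  show ?case by simp
next
  case (Suc n)
  have "1 * 1 \<le> partial_quot \<alpha> (Suc n) * cf_q_shift \<alpha> (Suc (Suc n))"
    using Suc partial_quot_ge_1[of "Suc n"] by (intro mult_mono) auto
  then show ?case using cf_q_shift_nonneg[of "Suc n"] by simp
qed

text \<open>The recursion adds a multiple of one vector to the other and swaps them, which flips the
  sign of the determinant.\<close>

lemma cf_shift_det:
  "cf_p_shift \<alpha> (Suc n) * cf_q_shift \<alpha> n - cf_p_shift \<alpha> n * cf_q_shift \<alpha> (Suc n) = (- 1) ^ n"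
proof (induction n)
  case 0
  show ?case by simp
next
  case (Suc n)
  have "cf_p_shift \<alpha> (Suc (Suc n)) * cf_q_shift \<alpha> (Suc n) - cf_p_shift \<alpha> (Suc n) * cf_q_shift \<alpha> (Suc (Suc n))
    = - (cf_p_shift \<alpha> (Suc n) * cf_q_shift \<alpha> n - cf_p_shift \<alpha> n * cf_q_shift \<alpha> (Suc n))"
    by (simp add: algebra_simps)
  then show ?case using Suc by simp
qed

text \<open>With the index shift of \<^const>\<open>cf_q_shift\<close>, \<open>cf_error (n + 2)\<close> is \<open>q\<^sub>n \<alpha> - p\<^sub>n\<close>, whereas
  the \<open>n\<close> of \<open>semi_p n m\<close> and \<open>semi_q n m\<close> below is that of \<open>E\<^sub>n\<close>.\<close>

definition cf_error :: "nat \<Rightarrow> real" where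
  "cf_error n = of_int (cf_q_shift \<alpha> n) * unit_rep \<alpha> - of_int (cf_p_shift \<alpha> n)"

lemma cf_error_Suc_Suc: "cf_error (Suc (Suc n)) = of_int (partial_quot \<alpha> n) * cf_error (Suc n) + cf_error n"
  by (simp add: cf_error_def algebra_simps)

text \<open>By the induction hypothesis, the recursion multiplies the error by
  \<open>- frac (complete_quot \<alpha> n)\<close>, whose inverse is, up to sign, the next complete
  quotient.\<close>

lemma cf_error_eq: "cf_error n = - complete_quot \<alpha> n * cf_error (Suc n)"
proof (induction n)
  case 0
  show ?case by (simp add: cf_error_def)
next
  case (Suc n)
  have "cf_error (Suc (Suc n)) = - frac (complete_quot \<alpha> n) * cf_error (Suc n)"
    unfolding cf_error_Suc_Suc Suc by (simp add: partial_quot_def frac_def algebra_simps)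
  then show ?case using frac_complete_quot_pos[of n] by (simp add: field_simps)
qed

lemma complete_quot_pos: "0 < complete_quot \<alpha> n"
  using partial_quot_less[of n] partial_quot_nonneg[of n] by linarith

text \<open>Complete quotients are positive, so \<open>cf_error_eq\<close> makes successive errors
  alternate: the convergents lie in turn on either side of \<alpha>.\<close>

lemma cf_error_sign: "0 < (- 1) ^ n * cf_error n"
proof (induction n)
  case 0
  show ?case by (simp add: cf_error_def unit_rep_pos)
next
  case (Suc n)
  have "0 < complete_quot \<alpha> n * ((- 1) ^ Suc n * cf_error (Suc n))"
    using Suc unfolding cf_error_eq[of n] by (simp add: mult_ac)
  then show ?case
    using complete_quot_pos[of n] by (simp only: zero_less_mult_iff) linarith
qed

definition semi_p :: "nat \<Rightarrow> int \<Rightarrow> int" where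
  "semi_p n m = m * cf_p_shift \<alpha> (Suc n) + cf_p_shift \<alpha> n"

definition semi_q :: "nat \<Rightarrow> int \<Rightarrow> int" where
  "semi_q n m = m * cf_q_shift \<alpha> (Suc n) + cf_q_shift \<alpha> n"

text \<open>The error is linear in \<open>m\<close> and vanishes at
  \<open>complete_quot \<alpha> n\<close>, which exceeds the partial quotient; up to there it keeps
  the sign of \<open>cf_error n\<close>.\<close>

lemma semi_sign:
  assumes "m \<le> partial_quot \<alpha> n"
  shows "0 < (- 1) ^ n * (of_int (semi_q n m) * unit_rep \<alpha> - of_int (semi_p n m))"
proof -
  have "of_int (semi_q n m) * unit_rep \<alpha> - of_int (semi_p n m) = of_int m * cf_error (Suc n) + cf_error n"
    by (simp add: semi_q_def semi_p_def cf_error_def algebra_simps)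
  also have "\<dots> = (- 1) * ((complete_quot \<alpha> n - of_int m) * cf_error (Suc n))"
    unfolding cf_error_eq[of n] by (simp add: algebra_simps)
  finally have "(- 1) ^ n * (of_int (semi_q n m) * unit_rep \<alpha> - of_int (semi_p n m)) =
      (complete_quot \<alpha> n - of_int m) * ((- 1) ^ Suc n * cf_error (Suc n))"
    by simp
  moreover have "real_of_int m \<le> of_int (partial_quot \<alpha> n)" using assms by simp
  then have "0 < complete_quot \<alpha> n - of_int m" using partial_quot_less[of n] by linarith
  ultimately show ?thesis using cf_error_sign[of "Suc n"] by (simp only: mult_pos_pos)
qed

lemma convergent_set_eq:
  assumes "n \<ge> 1"
  shows "convergent_set \<alpha> n =
    {mod_one (of_int (semi_p n m) / of_int (semi_q n m)) |m. 1 \<le> m \<and> m \<le> partial_quot \<alpha> n}"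
proof -
  have "nat (int n - 1 + 2) = Suc n" "nat (int n - 2 + 2) = n" by simp_all
  then show ?thesis
    by (simp only: convergent_set_def cf_p_def cf_q_def semi_p_def semi_q_def)
qed

text \<open>The pairs of Stern--Brocot neighbours enclosing \<open>\<alpha>\<close> form a chain: subtracting the smaller
  vector from the larger one gives the parent pair, which still encloses \<open>\<alpha>\<close>. Read upwards from
  \<open>0/1, 1/0\<close>, each step replaces one end by the mediant, and the side on which the mediant lies
  decides which end.\<close>

lemma enclosing_pair_cases:
  fixes a b c d :: int
  assumes "c * b - a * d = 1" "0 \<le> a" "0 \<le> b" "0 \<le> c" "0 \<le> d"
    and "of_int a < of_int b * unit_rep \<alpha>" "of_int d * unit_rep \<alpha> < of_int c"
  shows "\<exists>n\<ge>1. \<exists>m\<ge>0. m < partial_quot \<alpha> n \<and>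
    (odd n \<and> a = cf_p_shift \<alpha> (Suc n) \<and> b = cf_q_shift \<alpha> (Suc n) \<and> c = semi_p n m \<and> d = semi_q n m \<or>
     even n \<and> c = cf_p_shift \<alpha> (Suc n) \<and> d = cf_q_shift \<alpha> (Suc n) \<and> a = semi_p n m \<and> b = semi_q n m)"
    (is "?P a b c d")
  using assms
proof (induction "nat (a + b + c + d)" arbitrary: a b c d rule: less_induct)
  case less
  have next_level: "semi_p (Suc n) 0 = cf_p_shift \<alpha> (Suc n)" "semi_q (Suc n) 0 = cf_q_shift \<alpha> (Suc n)"
    "semi_p n (partial_quot \<alpha> n) = cf_p_shift \<alpha> (Suc (Suc n))"
    "semi_q n (partial_quot \<alpha> n) = cf_q_shift \<alpha> (Suc (Suc n))" for n
    by (simp_all add: semi_p_def semi_q_def)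
  have step: "semi_p n (m + 1) = semi_p n m + cf_p_shift \<alpha> (Suc n)"
    "semi_q n (m + 1) = semi_q n m + cf_q_shift \<alpha> (Suc n)" for n m
    by (simp_all add: semi_p_def semi_q_def algebra_simps)
  consider (right) "a \<le> c" "b \<le> d" | (left) "c \<le> a" "d \<le> b"
    | (bad) "c < a" "b < d" | (root) "a < c" "d < b" by linarith
  then show ?case
  proof cases
    case bad
    then have "c * b \<le> a * d" using less.prems by (intro mult_mono) auto
    then show ?thesis using less.prems(1) by simp
  next
    case root
    \<comment> \<open>Compared with \<open>c * b = a * d + 1\<close>, this forces
      \<open>a = d = 0\<close>: the root pair 0/1, 1/0, found at \<open>n = 1\<close>,
      \<open>m = 0\<close>.\<close>
    have "(a + 1) * (d + 1) \<le> c * b" using root less.prems by (intro mult_mono) auto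
    then have "a * d + a + d + 1 \<le> c * b" by (simp add: algebra_simps)
    then have "a = 0" "d = 0" using less.prems by linarith+
    moreover from this have "c * b = 1" using less.prems(1) by simp
    then have "c = 1" "b = 1"
      using less.prems(3,4) by (auto simp: zmult_eq_1_iff)
    ultimately show ?thesis
      using partial_quot_ge_1[of 1] partial_quot_0
      by (intro exI[of _ 1] conjI exI[of _ 0]) (auto simp: semi_p_def semi_q_def)
  next
    case right
    \<comment> \<open>The vector subtracted is nonzero by the determinant, so the measure
      decreases.\<close>
    have "a + b \<noteq> 0" using less.prems(1-3) by (auto simp: add_nonneg_eq_0_iff)
    then have "nat (a + b + (c - a) + (d - b)) < nat (a + b + c + d)"
      using less.prems right by linarith
    moreover have "(c - a) * b - a * (d - b) = 1"
      using less.prems(1) by (simp add: algebra_simps)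
    moreover have "of_int (d - b) * unit_rep \<alpha> < of_int (c - a)"
      using less.prems(6,7) by (simp add: algebra_simps)
    ultimately have "?P a b (c - a) (d - b)"
      using less.prems right by (intro less.hyps) auto
    then obtain n m where nm: "n \<ge> 1" "m \<ge> 0" "m < partial_quot \<alpha> n" and
      cases: "odd n \<and> a = cf_p_shift \<alpha> (Suc n) \<and> b = cf_q_shift \<alpha> (Suc n) \<and> c - a = semi_p n m \<and> d - b = semi_q n m \<or>
        even n \<and> c - a = cf_p_shift \<alpha> (Suc n) \<and> d - b = cf_q_shift \<alpha> (Suc n) \<and> a = semi_p n m \<and> b = semi_q n m"
      by blast
    have cd: "c = semi_p n (m + 1)" "d = semi_q n (m + 1)"
      using cases unfolding step by auto
    \<comment> \<open>In both alternatives \<open>c/d\<close> is the point with parameter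
      \<open>m + 1\<close>. It lies to the right of \<alpha>, and by \<open>semi_sign\<close> this
      happens only for odd \<open>n\<close>.\<close>
    have "odd n"
    proof
      assume "even n"
      then show False using semi_sign[of "m + 1" n] nm less.prems(7) by (simp add: cd)
    qed
    then have ab: "a = cf_p_shift \<alpha> (Suc n)" "b = cf_q_shift \<alpha> (Suc n)" using cases by auto
    show ?thesis
    proof (cases "m + 1 < partial_quot \<alpha> n")
      case True
      then show ?thesis using nm \<open>odd n\<close> ab cd
        by (intro exI[of _ n] conjI exI[of _ "m + 1"]) auto
    next
      case False
      \<comment> \<open>Level \<open>n\<close> is exhausted: \<open>c/d\<close> is its convergent,
        and \<open>a/b\<close> becomes the \<open>m = 0\<close> point of level
        \<open>Suc n\<close>.\<close>
      then have "m + 1 = partial_quot \<alpha> n" using nm by simp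
      then show ?thesis using nm \<open>odd n\<close> ab cd partial_quot_ge_1[of "Suc n"]
        by (intro exI[of _ "Suc n"] conjI exI[of _ 0]) (auto simp: next_level)
    qed
  next
    case left
    \<comment> \<open>Mirror image of the previous case, with the ends and the parities
      exchanged.\<close>
    have "c + d \<noteq> 0" using less.prems(1,4,5) by (auto simp: add_nonneg_eq_0_iff)
    then have "nat ((a - c) + (b - d) + c + d) < nat (a + b + c + d)"
      using less.prems left by linarith
    moreover have "c * (b - d) - (a - c) * d = 1"
      using less.prems(1) by (simp add: algebra_simps)
    moreover have "of_int (a - c) < of_int (b - d) * unit_rep \<alpha>"
      using less.prems(6,7) by (simp add: algebra_simps)
    ultimately have "?P (a - c) (b - d) c d"
      using less.prems left by (intro less.hyps) auto
    then obtain n m where nm: "n \<ge> 1" "m \<ge> 0" "m < partial_quot \<alpha> n" and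
      cases: "odd n \<and> a - c = cf_p_shift \<alpha> (Suc n) \<and> b - d = cf_q_shift \<alpha> (Suc n) \<and> c = semi_p n m \<and> d = semi_q n m \<or>
        even n \<and> c = cf_p_shift \<alpha> (Suc n) \<and> d = cf_q_shift \<alpha> (Suc n) \<and> a - c = semi_p n m \<and> b - d = semi_q n m"
      by blast
    have ab: "a = semi_p n (m + 1)" "b = semi_q n (m + 1)"
      using cases unfolding step by auto
    have "even n"
    proof (rule ccontr)
      assume "odd n"
      then show False using semi_sign[of "m + 1" n] nm less.prems(6) by (simp add: ab)
    qed
    then have cd: "c = cf_p_shift \<alpha> (Suc n)" "d = cf_q_shift \<alpha> (Suc n)" using cases by auto
    show ?thesis
    proof (cases "m + 1 < partial_quot \<alpha> n")
      case True
      then show ?thesis using nm \<open>even n\<close> ab cd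
        by (intro exI[of _ n] conjI exI[of _ "m + 1"]) auto
    next
      case False
      then have "m + 1 = partial_quot \<alpha> n" using nm by simp
      then show ?thesis using nm \<open>even n\<close> ab cd partial_quot_ge_1[of "Suc n"]
        by (intro exI[of _ "Suc n"] conjI exI[of _ 0]) (auto simp: next_level)
    qed
  qed
qed

text \<open>Adding the two ends raises \<open>m\<close> by 1, which turns the range of enclosing
  pairs, starting at 0, into the range defining E_n, starting at 1.\<close>

lemma mediant_in_convergent_set:
  fixes a b c d :: int
  assumes "c * b - a * d = 1" "0 \<le> a" "0 \<le> b" "0 \<le> c" "0 \<le> d"
    and "of_int a < of_int b * unit_rep \<alpha>" "of_int d * unit_rep \<alpha> < of_int c"
  shows "\<exists>n\<ge>1. mod_one (of_int (a + c) / of_int (b + d)) \<in> convergent_set \<alpha> n"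
proof -
  obtain n m where nm: "n \<ge> 1" "m \<ge> 0" "m < partial_quot \<alpha> n"
    and cases: "odd n \<and> a = cf_p_shift \<alpha> (Suc n) \<and> b = cf_q_shift \<alpha> (Suc n) \<and> c = semi_p n m \<and> d = semi_q n m \<or>
     even n \<and> c = cf_p_shift \<alpha> (Suc n) \<and> d = cf_q_shift \<alpha> (Suc n) \<and> a = semi_p n m \<and> b = semi_q n m"
    using enclosing_pair_cases[OF assms] by blast
  have "a + c = semi_p n (m + 1)" "b + d = semi_q n (m + 1)"
    using cases by (auto simp: semi_p_def semi_q_def algebra_simps)
  then show ?thesis
    unfolding convergent_set_eq[OF nm(1)] using nm
    by (intro exI[of _ n]) (auto simp: convergent_set_eq intro!: exI[of _ "m + 1"])
qed

lemma farey_fun_convergent_set: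
  assumes n: "n \<ge> 1" and \<beta>: "\<beta> \<in> convergent_set \<alpha> n"
  shows "farey_fun \<beta> \<alpha> = (- 1) ^ (n - 1) * of_int (cf_q_shift \<alpha> (Suc n))"
proof -
  obtain m where m: "1 \<le> m" "m \<le> partial_quot \<alpha> n"
    and \<beta>_eq: "\<beta> = mod_one (of_int (semi_p n m) / of_int (semi_q n m))"
    using \<beta> unfolding convergent_set_eq[OF n] by blast
  obtain k where k: "n = Suc k" using n by (cases n) auto
  define x where "x = unit_rep \<alpha>"
  define v w where "v = cf_p_shift \<alpha> (Suc n)" and "w = cf_q_shift \<alpha> (Suc n)"
  define r s where "r = semi_p n (m - 1)" and "s = semi_q n (m - 1)"
  have med: "semi_p n m = v + r" "semi_q n m = w + s"
    by (simp_all add: v_def w_def r_def s_def semi_p_def semi_q_def algebra_simps)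
  have w: "0 < w" using cf_q_shift_ge_1[of k] by (simp add: w_def k)
  have s: "0 \<le> s"
    using m w cf_q_shift_nonneg[of n] by (simp add: s_def semi_q_def flip: w_def)
  have det: "v * s - r * w = (- 1) ^ n"
    using cf_shift_det[of n] by (simp add: v_def w_def r_def s_def semi_p_def semi_q_def algebra_simps)
  have xa: "\<alpha> = mod_one x" and x: "x \<notin> \<rat>"
    by (simp_all add: x_def mod_one_unit_rep unit_rep_irrational)
  \<comment> \<open>The signs \<open>sv\<close> and \<open>sm\<close> place \<alpha> strictly
    between \<open>v/w\<close> and the mediant \<beta>. For even \<open>n\<close> the end
    \<open>v/w\<close> is the right one, for odd \<open>n\<close> the left one; its denominator
    \<open>w\<close> gives the value.\<close>
  have sv: "0 < (- 1) ^ Suc n * (of_int w * x - of_int v)"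
    using cf_error_sign[of "Suc n"] by (simp add: cf_error_def x_def v_def w_def)
  have sm: "0 < (- 1) ^ n * (of_int (w + s) * x - of_int (v + r))"
    using semi_sign[OF m(2)] by (simp add: x_def med)
  show ?thesis
  proof (cases "s = 0")
    \<comment> \<open>Here the other parent is the vector 1/0, which has no Farey neighbour behind
      it. Then \<beta> is the class of 1/1, that is 0, where the function is 1 by
      definition.\<close>
    case True
    have "n = 1"
    proof (rule ccontr)
      assume "n \<noteq> 1"
      then obtain j where "n = Suc (Suc j)" using k by (cases k) auto
      moreover have "0 \<le> (m - 1) * w" using m w by simp
      ultimately show False
        using True cf_q_shift_ge_1[of j] by (simp add: s_def semi_q_def w_def)
    qed
    then have "w = 1" by (simp add: w_def partial_quot_0)
    then have "\<beta> = 0" by (simp add: \<beta>_eq med True mod_one_eq_0_iff)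
    then show ?thesis using \<open>n = 1\<close> \<open>w = 1\<close> by (simp add: farey_fun_def flip: w_def)
  next
    case False
    then have s: "0 < s" using s by simp
    show ?thesis
    proof (cases "even n")
      case True
      have "farey_fun (mod_one (of_int (r + v) / of_int (s + w))) (mod_one x) = - of_int w"
        using det sv sm True s w x
        by (intro farey_fun_right_of_mediant) (auto simp: field_simps)
      then have "farey_fun \<beta> \<alpha> = - of_int w"
        by (simp only: \<beta>_eq med flip: xa) (simp only: add.commute)
      then show ?thesis using True n by (simp flip: w_def)
    next
      case odd: False
      have "farey_fun (mod_one (of_int (v + r) / of_int (w + s))) (mod_one x) = of_int w"
        using det sv sm odd s w x
        by (intro farey_fun_left_of_mediant) (auto simp: field_simps)
      then have "farey_fun \<beta> \<alpha> = of_int w"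
        by (simp only: \<beta>_eq med flip: xa)
      then show ?thesis using odd n by (simp flip: w_def)
    qed
  qed
qed

lemma farey_fun_nonzero_imp_convergent_set:
  assumes "\<beta> \<in> rat_circle" and nz: "farey_fun \<beta> \<alpha> \<noteq> 0"
  shows "\<exists>n\<ge>1. \<beta> \<in> convergent_set \<alpha> n"
proof (cases "\<beta> = 0")
  case True
  have "mod_one 1 = 0" by (simp add: mod_one_eq_0_iff)
  \<comment> \<open>The point 0 occurs in E_1 as 1/1, with \<open>m = 1\<close>.\<close>
  then have "\<beta> \<in> convergent_set \<alpha> 1"
    using True partial_quot_ge_1[of 1] partial_quot_0
    by (auto simp: convergent_set_eq semi_p_def semi_q_def intro!: exI[of _ 1])
  then show ?thesis by blast
next
  case False
  obtain p q :: int where pq: "0 < q" "coprime p q" "0 \<le> p" "p < q"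
    and \<beta>: "\<beta> = mod_one (of_int p / of_int q)"
    using assms(1) by (rule rat_circle_fraction)
  have "p \<noteq> 0" using False by (auto simp: \<beta> mod_one_eq_0_iff)
  then have "0 < p" using pq by simp
  obtain a b c d :: int where abcd: "c * b - a * d = 1" "0 < b" "0 < d" "0 \<le> a" "c \<le> d" "0 \<le> c"
    and pq_eq: "p = a + c" "q = b + d"
    using mediant_decomposition[OF pq(2) \<open>0 < p\<close> pq(4)] .
  have "of_int a / of_int b < unit_rep \<alpha> \<and> unit_rep \<alpha> < of_int c / of_int d"
    using nz unit_rep_irrational unit_rep_pos unit_rep_less_1 abcd
    by (intro farey_fun_nonzero_imp_between) (auto simp: mod_one_unit_rep \<beta> pq_eq)
  then have "of_int a < of_int b * unit_rep \<alpha>" "of_int d * unit_rep \<alpha> < of_int c"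
    using abcd by (simp_all add: field_simps)
  then show ?thesis
    unfolding \<beta> pq_eq using abcd by (intro mediant_in_convergent_set) auto
qed

end

theorem theorem1:
  fixes \<alpha> \<beta> :: circle
  assumes "\<alpha> \<notin> rat_circle"
    and "\<beta> \<in> rat_circle"
  shows "(farey_fun \<beta> \<alpha> \<noteq> 0 \<longleftrightarrow> (\<exists>n\<ge>1. \<beta> \<in> convergent_set \<alpha> n)) \<and>
         (\<forall>n\<ge>1. \<beta> \<in> convergent_set \<alpha> n \<longrightarrow>
            farey_fun \<beta> \<alpha> = (- 1) ^ (n - 1) * of_int (cf_q \<alpha> (int n - 1)))"
proof -
  have shift: "cf_q \<alpha> (int n - 1) = cf_q_shift \<alpha> (Suc n)" for n
  proof -
    have "nat (int n - 1 + 2) = Suc n" by simp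
    then show ?thesis by (simp only: cf_q_def)
  qed
  have val: "farey_fun \<beta> \<alpha> = (- 1) ^ (n - 1) * of_int (cf_q_shift \<alpha> (Suc n))"
    if "n \<ge> 1" "\<beta> \<in> convergent_set \<alpha> n" for n
    using farey_fun_convergent_set[OF assms(1) that] .
  \<comment> \<open>For \<open>n \<ge> 1\<close> the value is, up to sign, a denominator of index at
    least 0, hence nonzero; so the value formula yields the backward implication.\<close>
  have "farey_fun \<beta> \<alpha> \<noteq> 0" if "n \<ge> 1" "\<beta> \<in> convergent_set \<alpha> n" for n
  proof -
    obtain k where "n = Suc k" using \<open>n \<ge> 1\<close> by (cases n) auto
    then have "1 \<le> cf_q_shift \<alpha> (Suc n)" using cf_q_shift_ge_1[OF assms(1), of k] by simp
    then have "cf_q_shift \<alpha> (Suc n) \<noteq> 0" by linarith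
    then show ?thesis unfolding val[OF that] by simp
  qed
  then show ?thesis
    unfolding shift using val farey_fun_nonzero_imp_convergent_set[OF assms] by blast
qed

end
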